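(* Consider the D2T4 scheme in breathing moments, $m_r(t+\Delta t)=\exp(-\Delta t\,\Lambda_r)\,J_{0r}\,m_r(t)$ (with $\Lambda_r$, $J_{0r}$ as in the context), in the diffusive case: one conserved moment $W=\rho$ and equilibrium of the nonconserved moments $(J_x,J_y,e)$ equal to $(0,0,\alpha\lambda^2\rho)$. Assume $s_j\neq0$, $s_j\ne2$, $s_e\ne0$, $\alpha+3\neq0$ and put $\sigma_j=\frac1{s_j}-\frac12$. Then the second order equivalent partial differential equation of the scheme is $$\frac{\partial\rho}{\partial t}-\frac{\lambda^2}{8}(\alpha+3)\,\Delta t\,\sigma_j\,\big(\partial_x^2+\partial_y^2\big)\rho={\rm O}(\Delta t^2),$$ that is, in the notation of the context, $\alpha_1=0$ and $\alpha_2=-\frac{\lambda^2}{8}(\alpha+3)\,\sigma_j\,(\partial_x^2+\partial_y^2)$.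
   Context: Parameters: $\Delta t>0$, $\lambda>0$ fixed, real $\alpha,s_j,s_e$. Velocities: $v_1^\ell=(\lambda,0)$, $v_2^\ell=(-\frac12\lambda,\frac{\sqrt3}2\lambda)$, $v_3^\ell=(-\frac12\lambda,-\frac{\sqrt3}2\lambda)$, $v_j^r=-v_j^\ell$; $\xi.\nabla=\xi_x\partial_x+\xi_y\partial_y$. Matrices ($M^{-\ell}=(M^\ell)^{-1}$, $M^{-r}=(M^r)^{-1}$): $$M^\ell=\begin{pmatrix}1&1&1&1\\0&\lambda&-\frac12\lambda&-\frac12\lambda\\0&0&\frac{\sqrt3}{2}\lambda&-\frac{\sqrt3}{2}\lambda\\-3\lambda^2&\lambda^2&\lambda^2&\lambda^2\end{pmatrix},\quad M^r=\begin{pmatrix}1&1&1&1\\0&-\lambda&\frac12\lambda&\frac12\lambda\\0&0&-\frac{\sqrt3}{2}\lambda&\frac{\sqrt3}{2}\lambda\\-3\lambda^2&\lambda^2&\lambda^2&\lambda^2\end{pmatrix},$$ $$w.\nabla=\mathrm{diag}\big(0,0,(v_2^\ell-v_1^\ell).\nabla,(v_3^\ell-v_1^\ell).\nabla,0,0,(v_2^r-v_1^r).\nabla,(v_3^r-v_1^r).\nabla\big),$$ $$N_0=\begin{pmatrix}{\rm I}_4&{\rm I}_4\\-{\rm I}_4&{\rm I}_4\end{pmatrix},\quad N_1=\begin{pmatrix}{\rm I}_4&0\\0&N_1'\end{pmatrix},\quad N_1'=\begin{pmatrix}\frac14&0&0&-\frac1{4\lambda^2}\\0&1&0&0\\0&0&1&0\\\frac34&0&0&\frac1{4\lambda^2}\end{pmatrix},\quad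 R_p=\mathrm{diag}(1,1,1,1,1,-1,-1,-1),$$ $$J_0=\begin{pmatrix}1&0&0&0\\0&1-s_j&0&0\\0&0&1-s_j&0\\\alpha\lambda^2s_e&0&0&1-s_e\end{pmatrix},\qquad J_{0d}=\begin{pmatrix}J_0&0\\0&J_0\end{pmatrix},$$ $$\Lambda_r=N_1N_0\begin{pmatrix}M^\ell&0\\0&M^r\end{pmatrix}(w.\nabla)\begin{pmatrix}M^{-\ell}&0\\0&M^{-r}\end{pmatrix}N_0^{-1}N_1^{-1},\qquad J_{0r}=N_1N_0J_{0d}N_0^{-1}N_1^{-1}R_p.$$ The vector $m_r$ collects eight moments for a pair $X=(x^\ell,x^r)$ of neighboring triangle centers: $m_r=R_p^{-1}N_1N_0\,m_d$, with $m_d=(m(x^\ell),m(x^r))^{\rm t}$ and $m=(\rho,J_x,J_y,e)^{\rm t}$ the moments in each triangle. Second order equivalent partial differential equation. Split $m_r=(W,Y)$, where $W$ is the first component of $m_r$ (still denoted $\rho$) and $Y$ the seven others. Correspondingly $J_{0r}$ has the form $J_{0r}=\begin{pmatrix}{\rm I}&0\\S\,E&{\rm I}-S\end{pmatrix}$, with $$E=(0,0,\lambda^2\alpha,0,0,0,0)^{\rm t},\qquad S=\begin{pmatrix}s_j&0&0&0&0&0&0\\0&s_j&0&0&0&0&0\\0&0&s_e&0&0&0&0\\0&0&0&\frac14s_e(\alpha+3)&0&0&\frac14s_e(1-\alpha)\\0&0&0&0&2-s_j&0&0\\0&0&0&0&0&2-s_j&0\\0&0&0&-\frac14s_e(\alpha+3)&0&0&2-\frac14s_e(1-\alpha)\end{pmatrix},$$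 and $\Lambda_r=\begin{pmatrix}A&B\\C&D\end{pmatrix}$ is split into blocks with $A$ of size $1\times1$ and $D$ of size $7\times 7$ (entries are constant-coefficient first-order differential operators, which commute). Set $\Sigma=S^{-1}-\frac12{\rm I}_7$. By definition, the second order equivalent partial differential equation is $\partial_tW+\alpha_1W+\Delta t\,\alpha_2W={\rm O}(\Delta t^2)$ (formal expansion as $\Delta t\to0$, $\lambda$ fixed), where $$\alpha_1=A+B\,E,\qquad\beta_1=E\,\alpha_1-(C+D\,E),\qquad\alpha_2=B\,\Sigma\,\beta_1 .$$ *)

theory Defs
  imports
    "HOL-Analysis.Derivative"
    "HOL-Computational_Algebra.Polynomial"
    "Jordan_Normal_Form.Gauss_Jordan_Elimination"
begin

section \<open>Constant-coefficient differential operators in the plane\<close>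

text \<open>
  The commutative ring of differential operators with constant real coefficients is
  represented by polynomials in two variables: the inner variable stands for the derivative
  with respect to \<open>x\<close>, the outer one for the derivative with respect to \<open>y\<close>, and multiplication
  is composition.
\<close>

type_synonym diff_op = "real poly poly"

definition const_op :: "real \<Rightarrow> diff_op" where
  "const_op c = [:[:c:]:]"

definition d_x :: diff_op where
  "d_x = [:[:0, 1:]:]"

definition d_y :: diff_op where
  "d_y = [:0, 1:]"

text \<open>\<open>directional \<xi>\<close> is the operator usually written \<open>\<xi>.\<nabla>\<close>.\<close>

definition directional :: "real \<times> real \<Rightarrow> diff_op" where
  "directional \<xi> = const_op (fst \<xi>) * d_x + const_op (snd \<xi>) * d_y"

definition const_op_mat :: "real mat \<Rightarrow> diff_op mat" where
  "const_op_mat A = map_mat const_op A"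

definition partial_x :: "(real \<times> real \<Rightarrow> real) \<Rightarrow> real \<times> real \<Rightarrow> real" where
  "partial_x u = (\<lambda>(x, y). deriv (\<lambda>s. u (s, y)) x)"

definition partial_y :: "(real \<times> real \<Rightarrow> real) \<Rightarrow> real \<times> real \<Rightarrow> real" where
  "partial_y u = (\<lambda>(x, y). deriv (\<lambda>s. u (x, s)) y)"

text \<open>
  The action of an operator on a scalar field. It is multiplicative in the operator only on
  smooth fields, where the partial derivatives commute.
\<close>

definition apply_op :: "diff_op \<Rightarrow> (real \<times> real \<Rightarrow> real) \<Rightarrow> real \<times> real \<Rightarrow> real" where
  "apply_op P u p =
     (\<Sum>j\<le>degree P. \<Sum>i\<le>degree (coeff P j).
        coeff (coeff P j) i * (partial_x ^^ i) ((partial_y ^^ j) u) p)"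

lemma apply_op_d_x: "apply_op d_x u = partial_x u"
  by (auto simp: apply_op_def d_x_def)

lemma apply_op_d_y: "apply_op d_y u = partial_y u"
  by (auto simp: apply_op_def d_y_def)

lemma apply_op_const_op: "apply_op (const_op c) u = (\<lambda>p. c * u p)"
  by (auto simp: apply_op_def const_op_def)


section \<open>Second order equivalent equation of a scheme with one conserved moment\<close>

text \<open>The inverse of an invertible real matrix; unspecified otherwise.\<close>

definition minv :: "real mat \<Rightarrow> real mat" where
  "minv A = the (mat_inverse A)"

text \<open>
  A scheme \<open>m(t + \<Delta>t) = exp(- \<Delta>t \<Lambda>) J m(t)\<close> is given by its advection operator \<open>\<Lambda>\<close> and its
  relaxation matrix \<open>J\<close>. With \<open>m\<close> split into one conserved moment \<open>W\<close> and \<open>n\<close> others \<open>Y\<close>, the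
  predicate below says that \<open>J\<close> leaves \<open>W\<close> unchanged and replaces \<open>Y\<close> by
  \<open>S E W + (1 - S) Y\<close>: relaxation towards the equilibrium \<open>E W\<close>.
\<close>

definition relaxation_form :: "nat \<Rightarrow> real mat \<Rightarrow> real mat \<Rightarrow> real mat \<Rightarrow> bool" where
  "relaxation_form n J E S \<longleftrightarrow>
     E \<in> carrier_mat n 1 \<and> S \<in> carrier_mat n n \<and> invertible_mat S \<and>
     J = four_block_mat (1\<^sub>m 1) (0\<^sub>m 1 n) (S * E) (1\<^sub>m n - S)"

definition block_A :: "diff_op mat \<Rightarrow> diff_op mat" where
  "block_A \<Lambda> = (case split_block \<Lambda> 1 1 of (A, B, C, D) \<Rightarrow> A)"

definition block_B :: "diff_op mat \<Rightarrow> diff_op mat" where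
  "block_B \<Lambda> = (case split_block \<Lambda> 1 1 of (A, B, C, D) \<Rightarrow> B)"

definition block_C :: "diff_op mat \<Rightarrow> diff_op mat" where
  "block_C \<Lambda> = (case split_block \<Lambda> 1 1 of (A, B, C, D) \<Rightarrow> C)"

definition block_D :: "diff_op mat \<Rightarrow> diff_op mat" where
  "block_D \<Lambda> = (case split_block \<Lambda> 1 1 of (A, B, C, D) \<Rightarrow> D)"

text \<open>The 1 by 1 matrices \<open>\<alpha>\<^sub>1\<close> and \<open>\<alpha>\<^sub>2\<close> are identified with their single entry.\<close>

definition alpha1 :: "diff_op mat \<Rightarrow> real mat \<Rightarrow> diff_op" where
  "alpha1 \<Lambda> E = (block_A \<Lambda> + block_B \<Lambda> * const_op_mat E) $$ (0, 0)"

definition beta1 :: "diff_op mat \<Rightarrow> real mat \<Rightarrow> diff_op mat" where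
  "beta1 \<Lambda> E =
     alpha1 \<Lambda> E \<cdot>\<^sub>m const_op_mat E - (block_C \<Lambda> + block_D \<Lambda> * const_op_mat E)"

definition Sigma_mat :: "real mat \<Rightarrow> real mat" where
  "Sigma_mat S = minv S - (1 / 2) \<cdot>\<^sub>m 1\<^sub>m (dim_row S)"

definition alpha2 :: "diff_op mat \<Rightarrow> real mat \<Rightarrow> real mat \<Rightarrow> diff_op" where
  "alpha2 \<Lambda> E S = (block_B \<Lambda> * const_op_mat (Sigma_mat S) * beta1 \<Lambda> E) $$ (0, 0)"

text \<open>
  The equivalent equation is the formal relation
  \<open>\<partial>\<^sub>t W + \<alpha>\<^sub>1 W + \<Delta>t \<alpha>\<^sub>2 W = O(\<Delta>t\<^sup>2)\<close>; this is its left-hand side, for a field \<open>W t (x, y)\<close>.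
\<close>

definition equivalent_pde_lhs ::
  "diff_op mat \<Rightarrow> real mat \<Rightarrow> real mat \<Rightarrow> real \<Rightarrow> (real \<Rightarrow> real \<times> real \<Rightarrow> real)
     \<Rightarrow> real \<Rightarrow> real \<times> real \<Rightarrow> real" where
  "equivalent_pde_lhs \<Lambda> E S dt W t p =
     deriv (\<lambda>\<tau>. W \<tau> p) t + apply_op (alpha1 \<Lambda> E) (W t) p + dt * apply_op (alpha2 \<Lambda> E S) (W t) p"


section \<open>The D2T4 scheme in breathing moments\<close>

text \<open>The indices of the velocities are 1, 2, 3; those of matrices start at 0.\<close>

definition v_l :: "real \<Rightarrow> nat \<Rightarrow> real \<times> real" where
  "v_l lam j =
     (if j = 1 then (lam, 0)
      else if j = 2 then (- (1 / 2) * lam, sqrt 3 / 2 * lam)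
      else (- (1 / 2) * lam, - (sqrt 3 / 2) * lam))"

definition v_r :: "real \<Rightarrow> nat \<Rightarrow> real \<times> real" where
  "v_r lam j = - v_l lam j"

definition M_l :: "real \<Rightarrow> real mat" where
  "M_l lam = mat_of_rows_list 4
     [[1, 1, 1, 1],
      [0, lam, - (1 / 2) * lam, - (1 / 2) * lam],
      [0, 0, sqrt 3 / 2 * lam, - (sqrt 3 / 2) * lam],
      [- 3 * lam\<^sup>2, lam\<^sup>2, lam\<^sup>2, lam\<^sup>2]]"

definition M_r :: "real \<Rightarrow> real mat" where
  "M_r lam = mat_of_rows_list 4
     [[1, 1, 1, 1],
      [0, - lam, 1 / 2 * lam, 1 / 2 * lam],
      [0, 0, - (sqrt 3 / 2) * lam, sqrt 3 / 2 * lam],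
      [- 3 * lam\<^sup>2, lam\<^sup>2, lam\<^sup>2, lam\<^sup>2]]"

definition w_nabla :: "real \<Rightarrow> diff_op mat" where
  "w_nabla lam = mat_diag 8 (\<lambda>i.
     [0, 0, directional (v_l lam 2 - v_l lam 1), directional (v_l lam 3 - v_l lam 1),
      0, 0, directional (v_r lam 2 - v_r lam 1), directional (v_r lam 3 - v_r lam 1)] ! i)"

definition block_diag :: "real mat \<Rightarrow> real mat \<Rightarrow> real mat" where
  "block_diag P Q = four_block_mat P (0\<^sub>m 4 4) (0\<^sub>m 4 4) Q"

definition N_0 :: "real mat" where
  "N_0 = four_block_mat (1\<^sub>m 4) (1\<^sub>m 4) (- 1\<^sub>m 4) (1\<^sub>m 4)"

definition N_1' :: "real \<Rightarrow> real mat" where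
  "N_1' lam = mat_of_rows_list 4
     [[1 / 4, 0, 0, - 1 / (4 * lam\<^sup>2)],
      [0, 1, 0, 0],
      [0, 0, 1, 0],
      [3 / 4, 0, 0, 1 / (4 * lam\<^sup>2)]]"

definition N_1 :: "real \<Rightarrow> real mat" where
  "N_1 lam = block_diag (1\<^sub>m 4) (N_1' lam)"

definition R_p :: "real mat" where
  "R_p = mat_diag 8 (\<lambda>i. [1, 1, 1, 1, 1, -1, -1, -1] ! i)"

definition J_0 :: "real \<Rightarrow> real \<Rightarrow> real \<Rightarrow> real \<Rightarrow> real mat" where
  "J_0 lam \<alpha> sj se = mat_of_rows_list 4
     [[1, 0, 0, 0],
      [0, 1 - sj, 0, 0],
      [0, 0, 1 - sj, 0],
      [\<alpha> * lam\<^sup>2 * se, 0, 0, 1 - se]]"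

definition J_0d :: "real \<Rightarrow> real \<Rightarrow> real \<Rightarrow> real \<Rightarrow> real mat" where
  "J_0d lam \<alpha> sj se = block_diag (J_0 lam \<alpha> sj se) (J_0 lam \<alpha> sj se)"

definition Lambda_r :: "real \<Rightarrow> diff_op mat" where
  "Lambda_r lam =
     const_op_mat (N_1 lam * N_0 * block_diag (M_l lam) (M_r lam)) * w_nabla lam *
     const_op_mat (block_diag (minv (M_l lam)) (minv (M_r lam)) * minv N_0 * minv (N_1 lam))"

definition J_0r :: "real \<Rightarrow> real \<Rightarrow> real \<Rightarrow> real \<Rightarrow> real mat" where
  "J_0r lam \<alpha> sj se =
     N_1 lam * N_0 * J_0d lam \<alpha> sj se * minv N_0 * minv (N_1 lam) * R_p"

definition E_r :: "real \<Rightarrow> real \<Rightarrow> real mat" where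
  "E_r lam \<alpha> = mat_of_rows_list 1 [[0], [0], [lam\<^sup>2 * \<alpha>], [0], [0], [0], [0]]"

definition S_r :: "real \<Rightarrow> real \<Rightarrow> real \<Rightarrow> real mat" where
  "S_r \<alpha> sj se = mat_of_rows_list 7
     [[sj, 0, 0, 0, 0, 0, 0],
      [0, sj, 0, 0, 0, 0, 0],
      [0, 0, se, 0, 0, 0, 0],
      [0, 0, 0, 1 / 4 * se * (\<alpha> + 3), 0, 0, 1 / 4 * se * (1 - \<alpha>)],
      [0, 0, 0, 0, 2 - sj, 0, 0],
      [0, 0, 0, 0, 0, 2 - sj, 0],
      [0, 0, 0, - (1 / 4) * se * (\<alpha> + 3), 0, 0, 2 - 1 / 4 * se * (1 - \<alpha>)]]"

end

(*
  The advection matrix G of a left triangle in the moments (rho, J_x, J_y, e) and the one of a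
  right triangle differ only by the parity of the moments. In the sum and difference variables of
  N_0 the two combine into the even and odd parts of G, and after N_1 the first row of Lambda_r is
  (0, d_x, d_y, 0, 0, 0, 0, lam d_x). Its first and fourth entries vanish, and E only picks the
  fourth, so alpha_1 = 0. In alpha_2 the two momenta contribute sigma_j times the Laplacian. The
  last moment would produce an anisotropic second x-derivative, but the (7,7) entry of the inverse
  of S is exactly 1/2, so that it disappears from Sigma, and the off-diagonal entries of Sigma meet
  zeros of B or of beta_1.
*)
theory Submission
  imports Defs "Jordan_Normal_Form.Determinant"
begin

text \<open>Over a field a one-sided inverse of a square matrix is two-sided, so \<open>A\<close> is
  a unit of the matrix ring. Gauss-Jordan elimination then cannot return \<open>None\<close>, and
  uniqueness of inverses identifies its result with \<open>B\<close>.\<close>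

lemma minv_eqI:
  assumes A: "A \<in> carrier_mat n n" and B: "B \<in> carrier_mat n n" and AB: "A * B = 1\<^sub>m n"
  shows "minv A = B"
proof -
  have BA: "B * A = 1\<^sub>m n"
    using mat_mult_left_right_inverse[OF A B AB] .
  have "A \<in> Units (ring_mat TYPE(real) n ())"
    using A B AB BA by (auto simp: Units_def ring_mat_def)
  then obtain X where X: "mat_inverse A = Some X"
    using mat_inverse(1)[OF A, where b = "()"] by (cases "mat_inverse A") auto
  have XA: "X * A = 1\<^sub>m n" and Xc: "X \<in> carrier_mat n n"
    using mat_inverse(2)[OF A X] by auto
  have "X = X * (A * B)"
    using AB Xc by simp
  also have "\<dots> = B"
    using XA A B Xc by (simp flip: assoc_mult_mat)
  finally show ?thesis
    using X by (simp add: minv_def)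
qed

section \<open>Arithmetic of explicit matrices given by lists of rows\<close>

lemma mat_of_rows_list_carrier:
  "length A = m \<Longrightarrow> mat_of_rows_list n A \<in> carrier_mat m n"
  by (simp add: mat_of_rows_list_def)

text \<open>The inner sum runs over a list, so that \<open>upt_0_numeral\<close> lets the simplifier
  expand it term by term.\<close>

lemma mat_of_rows_list_mult:
  assumes "length B = n"
  shows "mat_of_rows_list n A * mat_of_rows_list m B =
    mat_of_rows_list m (map (\<lambda>r. map (\<lambda>j. \<Sum>k\<leftarrow>[0..<n]. r ! k * B ! k ! j) [0..<m]) A)"
  by (rule eq_matI)
    (use assms in \<open>auto simp: mat_of_rows_list_def scalar_prod_def interv_sum_list_conv_sum_set_nat\<close>)

lemma mat_of_rows_list_add:
  assumes "length B = length A"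
  shows "mat_of_rows_list n A + mat_of_rows_list n B =
    mat_of_rows_list n (map (\<lambda>i. map (\<lambda>j. A ! i ! j + B ! i ! j) [0..<n]) [0..<length A])"
  by (rule eq_matI) (use assms in \<open>auto simp: mat_of_rows_list_def\<close>)

lemma mat_of_rows_list_uminus:
  "- mat_of_rows_list n A =
    mat_of_rows_list n (map (\<lambda>r. map (\<lambda>j. - (r ! j)) [0..<n]) A)"
  by (rule eq_matI) (auto simp: mat_of_rows_list_def)

lemma const_op_mat_of_rows_list:
  "const_op_mat (mat_of_rows_list n A) =
    mat_of_rows_list n (map (\<lambda>r. map (\<lambda>j. const_op (r ! j)) [0..<n]) A)"
  by (rule eq_matI) (auto simp: mat_of_rows_list_def const_op_mat_def)

lemma const_op_mat_four_block:
  assumes "A \<in> carrier_mat nr1 nc1" "B \<in> carrier_mat nr1 nc2"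
    and "C \<in> carrier_mat nr2 nc1" "D \<in> carrier_mat nr2 nc2"
  shows "const_op_mat (four_block_mat A B C D) =
    four_block_mat (const_op_mat A) (const_op_mat B) (const_op_mat C) (const_op_mat D)"
  unfolding const_op_mat_def using assms by (rule map_four_block_mat)

lemma mat_diag_of_rows_list:
  "mat_diag n f =
    mat_of_rows_list n (map (\<lambda>i. map (\<lambda>j. if i = j then f j else 0) [0..<n]) [0..<n])"
  by (rule eq_matI) (auto simp: mat_of_rows_list_def mat_diag_def)

lemma mat_of_rows_list_one:
  "1\<^sub>m n = mat_of_rows_list n (map (\<lambda>i. map (\<lambda>j. if i = j then 1 else 0) [0..<n]) [0..<n])"
  by (rule eq_matI) (auto simp: mat_of_rows_list_def)

lemma mat_of_rows_list_zero:
  "0\<^sub>m m n = mat_of_rows_list n (map (\<lambda>i. map (\<lambda>j. 0) [0..<n]) [0..<m])"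
  by (rule eq_matI) (auto simp: mat_of_rows_list_def)

lemma mat_of_rows_list_smult:
  "c \<cdot>\<^sub>m mat_of_rows_list n A =
    mat_of_rows_list n (map (\<lambda>r. map (\<lambda>j. c * r ! j) [0..<n]) A)"
  by (rule eq_matI) (auto simp: mat_of_rows_list_def)

lemma mat_of_rows_list_minus:
  assumes "length B = length A"
  shows "mat_of_rows_list n A - mat_of_rows_list n B =
    mat_of_rows_list n (map (\<lambda>i. map (\<lambda>j. A ! i ! j - B ! i ! j) [0..<n]) [0..<length A])"
  by (rule eq_matI) (use assms in \<open>auto simp: mat_of_rows_list_def\<close>)

text \<open>Left rows must have length exactly \<open>m\<close>: an entry of a concatenated row is
  located by comparing its column index with that length.\<close>

lemma four_block_mat_of_rows_list:
  assumes "length B = length A" "length D = length C"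
    and "\<forall>r\<in>set A. length r = m" "\<forall>r\<in>set C. length r = m"
  shows "four_block_mat (mat_of_rows_list m A) (mat_of_rows_list n B)
      (mat_of_rows_list m C) (mat_of_rows_list n D) =
    mat_of_rows_list (m + n) (map2 (@) A B @ map2 (@) C D)"
  by (rule eq_matI) (use assms in \<open>auto simp: mat_of_rows_list_def nth_append\<close>)

lemma upt_0_numeral:
  "[0..<4] = [0, 1, 2, 3]"
  "[0..<7] = [0, 1, 2, 3, 4, 5, 6]"
  "[0..<8] = [0, 1, 2, 3, 4, 5, 6, 7]"
  by (simp_all add: upt_rec)

lemmas rows_simps = mat_of_rows_list_mult mat_of_rows_list_add mat_of_rows_list_uminus
  mat_of_rows_list_smult mat_of_rows_list_minus mat_of_rows_list_carrier
  const_op_mat_of_rows_list mat_of_rows_list_one mat_of_rows_list_zero mat_diag_of_rows_list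
  upt_0_numeral

text \<open>The block sizes are instantiated to 4 so that the carrier side conditions contain no
  unknown dimensions.\<close>

lemmas block_simps = mult_four_block_mat[of _ 4 4 _ 4 _ 4 _ _ 4 _ 4]
  const_op_mat_four_block[of _ 4 4 _ 4 _ 4]

section \<open>Inverse moment matrices and advection in a single triangle\<close>

definition M_l_inv :: "real \<Rightarrow> real mat" where
  "M_l_inv lam = mat_of_rows_list 4
     [[1 / 4, 0, 0, - 1 / (4 * lam\<^sup>2)],
      [1 / 4, 2 / (3 * lam), 0, 1 / (12 * lam\<^sup>2)],
      [1 / 4, - 1 / (3 * lam), sqrt 3 / (3 * lam), 1 / (12 * lam\<^sup>2)],
      [1 / 4, - 1 / (3 * lam), - sqrt 3 / (3 * lam), 1 / (12 * lam\<^sup>2)]]"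

definition M_r_inv :: "real \<Rightarrow> real mat" where
  "M_r_inv lam = mat_of_rows_list 4
     [[1 / 4, 0, 0, - 1 / (4 * lam\<^sup>2)],
      [1 / 4, - 2 / (3 * lam), 0, 1 / (12 * lam\<^sup>2)],
      [1 / 4, 1 / (3 * lam), - sqrt 3 / (3 * lam), 1 / (12 * lam\<^sup>2)],
      [1 / 4, 1 / (3 * lam), sqrt 3 / (3 * lam), 1 / (12 * lam\<^sup>2)]]"

text \<open>\<open>N_1'\<close> replaces density and energy by the density at rest and the density
  of the moving particles; this matrix recovers rho as their sum and e as \<open>lam\<^sup>2\<close>
  times (moving - 3 rest).\<close>

definition N_1'_inv :: "real \<Rightarrow> real mat" where
  "N_1'_inv lam = mat_of_rows_list 4
     [[1, 0, 0, 1],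
      [0, 1, 0, 0],
      [0, 0, 1, 0],
      [- 3 * lam\<^sup>2, 0, 0, lam\<^sup>2]]"

text \<open>The rows of \<open>M_l lam\<close> are pairwise orthogonal with squared norms 4, 3/2
  \<open>lam\<^sup>2\<close>, 3/2 \<open>lam\<^sup>2\<close>, 12 \<open>lam ^ 4\<close>. The inverse
  is the transpose with its columns divided by these norms; the same holds for
  \<open>M_r lam\<close>.\<close>

lemma minv_M_l: "lam \<noteq> 0 \<Longrightarrow> minv (M_l lam) = M_l_inv lam"
  by (rule minv_eqI[of _ 4])
    (simp_all add: M_l_def M_l_inv_def rows_simps field_simps power2_eq_square)

lemma minv_M_r: "lam \<noteq> 0 \<Longrightarrow> minv (M_r lam) = M_r_inv lam"
  by (rule minv_eqI[of _ 4])
    (simp_all add: M_r_def M_r_inv_def rows_simps field_simps power2_eq_square)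

definition g_nabla :: "real \<Rightarrow> diff_op mat" where
  "g_nabla lam = mat_of_rows_list 4
     [[0, 0, 0, 0],
      [0, 0, 0, 0],
      [0, 0, directional (v_l lam 2 - v_l lam 1), 0],
      [0, 0, 0, directional (v_l lam 3 - v_l lam 1)]]"

text \<open>Since \<open>d_x\<close> and \<open>d_y\<close> are linearly independent, identities
  between first order operators reduce to identities between real coefficients.\<close>

lemma directional_eq_iff: "directional (a, b) = directional (c, d) \<longleftrightarrow> a = c \<and> b = d"
  by (auto simp: directional_def const_op_def d_x_def d_y_def)

lemma directional_zero: "directional (0, 0) = 0"
  by (simp add: directional_def const_op_def)

lemma directional_add: "directional (a, b) + directional (c, d) = directional (a + c, b + d)"
  by (simp add: directional_def const_op_def d_x_def d_y_def)

lemma directional_uminus: "- directional (a, b) = directional (- a, - b)"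
  by (simp add: directional_def const_op_def d_x_def d_y_def)

lemma const_op_times_directional: "const_op c * directional (a, b) = directional (c * a, c * b)"
  by (simp add: directional_def const_op_def d_x_def d_y_def)

lemma directional_times_const_op: "directional (a, b) * const_op c = directional (a * c, b * c)"
  by (simp add: directional_def const_op_def d_x_def d_y_def)

lemma const_op_0: "const_op 0 = 0" by (simp add: const_op_def)

lemmas directional_simps = directional_zero directional_add directional_uminus
  const_op_times_directional directional_times_const_op const_op_0

lemma advection_l:
  assumes "lam \<noteq> 0"
  shows "const_op_mat (M_l lam) * g_nabla lam * const_op_mat (M_l_inv lam) = mat_of_rows_list 4
     [[directional (- 3 / 4 * lam, 0), directional (1, 0), directional (0, 1), directional (- 1 / (4 * lam), 0)],
      [directional (3 / 8 * lam\<^sup>2, 0), directional (- lam / 2, 0), directional (0, - lam / 2), directional (1 / 8, 0)],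
      [directional (0, 3 / 8 * lam\<^sup>2), directional (0, - lam / 2), directional (- 3 / 2 * lam, 0), directional (0, 1 / 8)],
      [directional (- 3 / 4 * lam ^ 3, 0), directional (lam\<^sup>2, 0), directional (0, lam\<^sup>2), directional (- lam / 4, 0)]]"
  using assms
  by (simp add: M_l_def M_l_inv_def g_nabla_def v_l_def rows_simps directional_simps)
    (simp add: field_simps power2_eq_square power3_eq_cube)

text \<open>With P = diag(1, -1, -1, 1) one has M^r = P M^l, so this is -P G P for the left matrix
  G: entries between moments of opposite parity agree, the others change sign.\<close>

lemma advection_r:
  assumes "lam \<noteq> 0"
  shows "const_op_mat (M_r lam) * (- g_nabla lam) * const_op_mat (M_r_inv lam) = mat_of_rows_list 4
     [[directional (3 / 4 * lam, 0), directional (1, 0), directional (0, 1), directional (1 / (4 * lam), 0)],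
      [directional (3 / 8 * lam\<^sup>2, 0), directional (lam / 2, 0), directional (0, lam / 2), directional (1 / 8, 0)],
      [directional (0, 3 / 8 * lam\<^sup>2), directional (0, lam / 2), directional (3 / 2 * lam, 0), directional (0, 1 / 8)],
      [directional (3 / 4 * lam ^ 3, 0), directional (lam\<^sup>2, 0), directional (0, lam\<^sup>2), directional (lam / 4, 0)]]"
  using assms
  by (simp add: M_r_def M_r_inv_def g_nabla_def v_l_def rows_simps directional_simps)
    (simp add: field_simps power2_eq_square power3_eq_cube)

section \<open>Assembly of the 8 by 8 advection matrix\<close>

interpretation const_op: comm_ring_hom const_op
  by standard (simp_all add: const_op_def one_pCons)

lemma const_op_mat_mult:
  "A \<in> carrier_mat m n \<Longrightarrow> B \<in> carrier_mat n k \<Longrightarrow>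
    const_op_mat (A * B) = const_op_mat A * const_op_mat B"
  unfolding const_op_mat_def by (rule const_op.mat_hom_mult)

lemma const_op_mat_carrier: "const_op_mat A \<in> carrier_mat m n \<longleftrightarrow> A \<in> carrier_mat m n"
  by (simp add: const_op_mat_def)

text \<open>Up to the factor sqrt 2, \<open>N_0\<close> is orthogonal, so half its transpose inverts
  it.\<close>

definition N_0_inv :: "real mat" where
  "N_0_inv = four_block_mat ((1 / 2) \<cdot>\<^sub>m 1\<^sub>m 4) (- ((1 / 2) \<cdot>\<^sub>m 1\<^sub>m 4))
     ((1 / 2) \<cdot>\<^sub>m 1\<^sub>m 4) ((1 / 2) \<cdot>\<^sub>m 1\<^sub>m 4)"

lemma minv_N_0: "minv N_0 = N_0_inv"
  by (rule minv_eqI[of _ 8])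
    (simp_all add: N_0_def N_0_inv_def rows_simps four_block_mat_of_rows_list)

definition N_1_inv :: "real \<Rightarrow> real mat" where
  "N_1_inv lam = block_diag (1\<^sub>m 4) (N_1'_inv lam)"

lemma minv_N_1: "lam \<noteq> 0 \<Longrightarrow> minv (N_1 lam) = N_1_inv lam"
  by (rule minv_eqI[of _ 8])
    (simp_all add: N_1_def N_1'_def N_1_inv_def N_1'_inv_def block_diag_def rows_simps
      four_block_mat_of_rows_list)

lemma w_nabla_eq:
  "w_nabla lam = four_block_mat (g_nabla lam) (0\<^sub>m 4 4) (0\<^sub>m 4 4) (- g_nabla lam)"
  by (simp add: w_nabla_def g_nabla_def v_r_def v_l_def directional_simps rows_simps
      four_block_mat_of_rows_list)

text \<open>The fifth moment is the difference of the rest densities. Particles at rest are not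
  advected, which makes its row and its column vanish; as e is \<open>lam\<^sup>2\<close> times (rho
  - 4 rest), the fourth row is \<open>lam\<^sup>2\<close> times the first.\<close>

definition Lambda_r_rows :: "real \<Rightarrow> diff_op list list" where
  "Lambda_r_rows lam =
     [[0, directional (1, 0), directional (0, 1), 0,
       0, 0, 0, directional (lam, 0)],
      [directional (3 / 8 * lam\<^sup>2, 0), 0, 0, directional (1 / 8, 0),
       0, directional (lam / 2, 0), directional (0, lam / 2), 0],
      [directional (0, 3 / 8 * lam\<^sup>2), 0, 0, directional (0, 1 / 8),
       0, directional (0, lam / 2), directional (3 / 2 * lam, 0), 0],
      [0, directional (lam\<^sup>2, 0), directional (0, lam\<^sup>2), 0,
       0, 0, 0, directional (lam ^ 3, 0)],
      [0, 0, 0, 0, 0, 0, 0, 0],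
      [0, directional (lam / 2, 0), directional (0, lam / 2), 0,
       0, 0, 0, directional (lam\<^sup>2 / 2, 0)],
      [0, directional (0, lam / 2), directional (3 / 2 * lam, 0), 0,
       0, 0, 0, directional (0, lam\<^sup>2 / 2)],
      [directional (3 / 4 * lam, 0), 0, 0, directional (1 / (4 * lam), 0),
       0, directional (1, 0), directional (0, 1), 0]]"

lemma const_op_mat_zero: "const_op_mat (0\<^sub>m m n) = 0\<^sub>m m n"
  by (rule eq_matI) (simp_all add: const_op_mat_def const_op_0)

lemma four_block_carrier_8:
  "A \<in> carrier_mat 4 4 \<Longrightarrow> D \<in> carrier_mat 4 4 \<Longrightarrow>
    four_block_mat A B C D \<in> carrier_mat 8 8"
  using four_block_carrier_mat[of A 4 4 D 4 4] by simp

lemma Lambda_r_eq: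
  assumes "lam \<noteq> 0"
  shows "Lambda_r lam = mat_of_rows_list 8 (Lambda_r_rows lam)"
proof -
  let ?c = const_op_mat
  let ?M = "block_diag (M_l lam) (M_r lam)"
  let ?Mi = "block_diag (M_l_inv lam) (M_r_inv lam)"
  have carrier4: "M_l lam \<in> carrier_mat 4 4" "M_r lam \<in> carrier_mat 4 4"
    "M_l_inv lam \<in> carrier_mat 4 4" "M_r_inv lam \<in> carrier_mat 4 4"
    "g_nabla lam \<in> carrier_mat 4 4"
    by (simp_all add: M_l_def M_r_def M_l_inv_def M_r_inv_def g_nabla_def mat_of_rows_list_carrier)
  have carrier8: "?M \<in> carrier_mat 8 8" "?Mi \<in> carrier_mat 8 8" "w_nabla lam \<in> carrier_mat 8 8"
    "N_0 \<in> carrier_mat 8 8" "N_0_inv \<in> carrier_mat 8 8"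
    "N_1 lam \<in> carrier_mat 8 8" "N_1_inv lam \<in> carrier_mat 8 8"
    using carrier4
    by (simp_all add: block_diag_def four_block_carrier_8 w_nabla_def N_0_def N_0_inv_def
        N_1_def N_1'_def N_1_inv_def N_1'_inv_def mat_of_rows_list_carrier)
  have zero: "- 0\<^sub>m 4 4 = (0\<^sub>m 4 4 :: diff_op mat)"
    by (rule eq_matI) simp_all
  have advection: "?c ?M * w_nabla lam * ?c ?Mi =
    four_block_mat (?c (M_l lam) * g_nabla lam * ?c (M_l_inv lam)) (0\<^sub>m 4 4) (0\<^sub>m 4 4)
      (?c (M_r lam) * (- g_nabla lam) * ?c (M_r_inv lam))"
    using carrier4
    by (simp add: w_nabla_eq block_diag_def block_simps const_op_mat_carrier const_op_mat_zero zero)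
  have "Lambda_r lam = ?c (N_1 lam * N_0 * ?M) * w_nabla lam * ?c (?Mi * N_0_inv * N_1_inv lam)"
    using assms by (simp add: Lambda_r_def minv_M_l minv_M_r minv_N_0 minv_N_1)
  \<comment> \<open>Regrouping puts the block diagonal advection innermost, so that conjugation by
    \<open>N_0\<close> and then by \<open>N_1 lam\<close> needs only 4 by 4 block products.\<close>
  also have "\<dots> = ?c (N_1 lam) * (?c N_0 * (?c ?M * w_nabla lam * ?c ?Mi) * ?c N_0_inv) * ?c (N_1_inv lam)"
    using carrier8
    by (simp add: const_op_mat_mult[of _ 8 8 _ 8] const_op_mat_carrier assoc_mult_mat[of _ 8 8 _ 8 _ 8])
  also have "\<dots> = mat_of_rows_list 8 (Lambda_r_rows lam)"
    unfolding advection advection_l[OF assms] advection_r[OF assms]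
    using assms
    by (simp add: N_0_def N_0_inv_def N_1_def N_1'_def N_1_inv_def N_1'_inv_def block_diag_def
        Lambda_r_rows_def rows_simps block_simps directional_simps)
      \<comment> \<open>Only now are the blocks merged into eight rows; the rows are then compared
        coefficient by coefficient.\<close>
      (simp add: four_block_mat_of_rows_list directional_simps,
        rule arg_cong[of _ _ "mat_of_rows_list 8"],
        simp add: directional_eq_iff field_simps power2_eq_square power3_eq_cube directional_simps)
  finally show ?thesis .
qed

section \<open>The relaxation matrix and its normal form\<close>

definition S_r_inv :: "real \<Rightarrow> real \<Rightarrow> real \<Rightarrow> real mat" where
  "S_r_inv \<alpha> sj se = mat_of_rows_list 7
     [[1 / sj, 0, 0, 0, 0, 0, 0],
      [0, 1 / sj, 0, 0, 0, 0, 0],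
      [0, 0, 1 / se, 0, 0, 0, 0],
      [0, 0, 0, (8 - se * (1 - \<alpha>)) / (2 * se * (\<alpha> + 3)), 0, 0, - (1 - \<alpha>) / (2 * (\<alpha> + 3))],
      [0, 0, 0, 0, 1 / (2 - sj), 0, 0],
      [0, 0, 0, 0, 0, 1 / (2 - sj), 0],
      [0, 0, 0, 1 / 2, 0, 0, 1 / 2]]"

text \<open>The only coupling is between indices 4 and 7 (counted from 1), through a block ((a, b),
  (-a, 2 - b)) with a = se (\<alpha> + 3) / 4 and b = se (1 - \<alpha>) / 4. Its determinant is 2a,
  and the lower row of its inverse is (1/2, 1/2).\<close>

lemma S_r_right_inverse:
  assumes "sj \<noteq> 0" "sj \<noteq> 2" "se \<noteq> 0" "\<alpha> + 3 \<noteq> 0"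
  shows "S_r \<alpha> sj se * S_r_inv \<alpha> sj se = 1\<^sub>m 7"
proof -
  \<comment> \<open>The denominator \<alpha> + 3 becomes a single variable known to be nonzero,
    which suits \<open>field_simps\<close>.\<close>
  define b where "b = \<alpha> + 3"
  have b: "b \<noteq> 0" "\<alpha> = b - 3"
    using assms by (simp_all add: b_def)
  show ?thesis
    using assms b(1) unfolding b(2)
    by (simp add: S_r_def S_r_inv_def rows_simps) (simp add: field_simps)
qed

lemma S_r_carrier: "S_r \<alpha> sj se \<in> carrier_mat 7 7"
  by (simp add: S_r_def mat_of_rows_list_carrier)

lemma S_r_inv_carrier: "S_r_inv \<alpha> sj se \<in> carrier_mat 7 7"
  by (simp add: S_r_inv_def mat_of_rows_list_carrier)

text \<open>The two diagonal blocks of \<open>J_0d\<close> are equal, so it commutes with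
  \<open>N_0\<close>: the product is diag(J_0, N_1' J_0 N_1'^(-1)) R_p. The sign flips in
  \<open>R_p\<close> turn 1 - sj into sj - 1, whence the entries 2 - sj of S.\<close>

lemma J_0r_eq:
  assumes "lam \<noteq> 0"
  shows "J_0r lam \<alpha> sj se =
    four_block_mat (1\<^sub>m 1) (0\<^sub>m 1 7) (S_r \<alpha> sj se * E_r lam \<alpha>) (1\<^sub>m 7 - S_r \<alpha> sj se)"
proof -
  \<comment> \<open>The 4 + 4 splitting matches the other factors; the 1 + 7 splitting of the result
    is compared only after both sides are flattened to eight rows.\<close>
  have R: "R_p = four_block_mat (1\<^sub>m 4) (0\<^sub>m 4 4) (0\<^sub>m 4 4) (mat_diag 4 (\<lambda>i. [1, -1, -1, -1] ! i))"
    by (simp add: R_p_def rows_simps four_block_mat_of_rows_list)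
  show ?thesis
    unfolding J_0r_def minv_N_0 minv_N_1[OF assms] R
    using assms
    by (simp add: N_0_def N_0_inv_def N_1_def N_1'_def N_1_inv_def
        N_1'_inv_def block_diag_def J_0d_def J_0_def S_r_def E_r_def rows_simps block_simps)
      (simp add: four_block_mat_of_rows_list, rule arg_cong[of _ _ "mat_of_rows_list 8"],
        simp add: field_simps)
qed

lemma relaxation_form_J_0r:
  assumes "lam \<noteq> 0" "sj \<noteq> 0" "sj \<noteq> 2" "se \<noteq> 0" "\<alpha> + 3 \<noteq> 0"
  shows "relaxation_form 7 (J_0r lam \<alpha> sj se) (E_r lam \<alpha>) (S_r \<alpha> sj se)"
proof -
  have right: "S_r \<alpha> sj se * S_r_inv \<alpha> sj se = 1\<^sub>m 7"
    using assms by (intro S_r_right_inverse)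
  then have "S_r_inv \<alpha> sj se * S_r \<alpha> sj se = 1\<^sub>m 7"
    by (rule mat_mult_left_right_inverse[OF S_r_carrier S_r_inv_carrier])
  with right have "invertible_mat (S_r \<alpha> sj se)"
    using S_r_carrier[of \<alpha> sj se] S_r_inv_carrier[of \<alpha> sj se]
    by (auto simp: invertible_mat_def inverts_mat_def square_mat.simps)
  moreover have "E_r lam \<alpha> \<in> carrier_mat 7 1"
    by (simp add: E_r_def mat_of_rows_list_carrier)
  ultimately show ?thesis
    using S_r_carrier J_0r_eq[OF assms(1)] by (simp add: relaxation_form_def)
qed

section \<open>The coefficients of the equivalent equation\<close>

lemma blocks_mat_of_rows_list:
  assumes "0 < n"
  shows "block_A (mat_of_rows_list n ((x # xs) # L)) = mat_of_rows_list 1 [[x]]"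
    "block_B (mat_of_rows_list n ((x # xs) # L)) = mat_of_rows_list (n - 1) [xs]"
    "block_C (mat_of_rows_list n ((x # xs) # L)) = mat_of_rows_list 1 (map (\<lambda>r. [r ! 0]) L)"
    "block_D (mat_of_rows_list n ((x # xs) # L)) =
      mat_of_rows_list (n - 1) (map (\<lambda>r. map (\<lambda>j. r ! Suc j) [0..<n - 1]) L)"
  unfolding block_A_def block_B_def block_C_def block_D_def split_block_def Let_def prod.case
  by (rule eq_matI; use assms in \<open>auto simp: mat_of_rows_list_def\<close>)+

lemma alpha1_eq_0:
  assumes "lam \<noteq> 0"
  shows "alpha1 (Lambda_r lam) (E_r lam \<alpha>) = 0"
  unfolding Lambda_r_eq[OF assms]
  by (simp add: alpha1_def Lambda_r_rows_def E_r_def blocks_mat_of_rows_list rows_simps const_op_0)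
    (simp add: mat_of_rows_list_def)

text \<open>With alpha_1 = 0 this is -(C + D E). The factor \<alpha> + 3 arises by adding the rho
  column to \<open>lam\<^sup>2\<close> \<alpha> times the e column, as in 3/8 + \<alpha>/8.\<close>

lemma beta1_eq:
  assumes "lam \<noteq> 0"
  shows "beta1 (Lambda_r lam) (E_r lam \<alpha>) = mat_of_rows_list 1
    [[directional (- lam\<^sup>2 / 8 * (\<alpha> + 3), 0)], [directional (0, - lam\<^sup>2 / 8 * (\<alpha> + 3))], [0], [0],
     [0], [0], [directional (- lam / 4 * (\<alpha> + 3), 0)]]"
  using assms
  \<comment> \<open>This rewriting has to precede the expansion of \<open>Lambda_r lam\<close>,
    which would hide the instance of alpha_1.\<close>
  unfolding beta1_def alpha1_eq_0[OF assms]
  unfolding Lambda_r_eq[OF assms]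
  by (simp add: Lambda_r_rows_def E_r_def blocks_mat_of_rows_list rows_simps directional_simps)
    (rule arg_cong[of _ _ "mat_of_rows_list _"],
      simp add: directional_eq_iff field_simps power2_eq_square)

lemma alpha2_eq:
  assumes "lam \<noteq> 0" "sj \<noteq> 0" "sj \<noteq> 2" "se \<noteq> 0" "\<alpha> + 3 \<noteq> 0"
  shows "alpha2 (Lambda_r lam) (E_r lam \<alpha>) (S_r \<alpha> sj se) =
    - const_op (lam\<^sup>2 / 8 * (\<alpha> + 3) * (1 / sj - 1 / 2)) * (d_x\<^sup>2 + d_y\<^sup>2)"
proof -
  have minv: "minv (S_r \<alpha> sj se) = S_r_inv \<alpha> sj se"
    using S_r_carrier S_r_inv_carrier S_r_right_inverse[OF assms(2-5)] by (rule minv_eqI)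
  have dim: "dim_row (S_r \<alpha> sj se) = 7"
    using S_r_carrier[of \<alpha> sj se] by simp
  \<comment> \<open>The fourth entry of B Sigma is \<open>directional (lam / 2, 0)\<close>, but it
    meets a zero of beta_1; the seventh is zero. The two momentum terms remain, as products of first
    order operators.\<close>
  have "alpha2 (Lambda_r lam) (E_r lam \<alpha>) (S_r \<alpha> sj se) =
    directional (1 / sj - 1 / 2, 0) * directional (- lam\<^sup>2 / 8 * (\<alpha> + 3), 0)
    + directional (0, 1 / sj - 1 / 2) * directional (0, - lam\<^sup>2 / 8 * (\<alpha> + 3))"
    unfolding alpha2_def Sigma_mat_def beta1_eq[OF assms(1)] minv dim
    unfolding Lambda_r_eq[OF assms(1)]
    by (simp add: Lambda_r_rows_def S_r_inv_def blocks_mat_of_rows_list rows_simps directional_simps)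
      (simp add: mat_of_rows_list_def)
  also have "\<dots> = - const_op (lam\<^sup>2 / 8 * (\<alpha> + 3) * (1 / sj - 1 / 2)) * (d_x\<^sup>2 + d_y\<^sup>2)"
    by (simp add: directional_def const_op_def d_x_def d_y_def power2_eq_square)
  finally show ?thesis .
qed

section \<open>Action of the operators on scalar fields\<close>

lemma apply_op_zero: "apply_op 0 u p = 0"
  by (simp add: apply_op_def)

text \<open>\<open>u\<close> is arbitrary, whereas \<open>apply_op\<close> is multiplicative only on
  smooth fields, so the operator is first expanded as a polynomial. The sums in
  \<open>apply_op\<close> stop at the degree, which drops when \<open>c = 0\<close>; hence the case
  distinction.\<close>

lemma apply_op_laplacian:
  "apply_op (- const_op c * (d_x\<^sup>2 + d_y\<^sup>2)) u p =
    - c * (partial_x (partial_x u) p + partial_y (partial_y u) p)"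
proof (cases "c = 0")
  case True
  then show ?thesis
    by (simp add: const_op_def apply_op_zero)
next
  case False
  have "- const_op c * (d_x\<^sup>2 + d_y\<^sup>2) = [:[:0, 0, - c:], 0, [:- c:]:]"
    by (simp add: const_op_def d_x_def d_y_def power2_eq_square)
  then show ?thesis
    using False by (simp add: apply_op_def algebra_simps)
qed

theorem proposition5:
  fixes lam \<alpha> sj se dt \<sigma>j :: real
  assumes "dt > 0" and "lam > 0"
    and "sj \<noteq> 0" and "sj \<noteq> 2" and "se \<noteq> 0" and "\<alpha> + 3 \<noteq> 0"
    and "\<sigma>j = 1 / sj - 1 / 2"
  shows "relaxation_form 7 (J_0r lam \<alpha> sj se) (E_r lam \<alpha>) (S_r \<alpha> sj se)
    \<and> alpha1 (Lambda_r lam) (E_r lam \<alpha>) = 0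
    \<and> alpha2 (Lambda_r lam) (E_r lam \<alpha>) (S_r \<alpha> sj se)
        = - const_op (lam\<^sup>2 / 8 * (\<alpha> + 3) * \<sigma>j) * (d_x\<^sup>2 + d_y\<^sup>2)
    \<and> (\<forall>\<rho> t p. equivalent_pde_lhs (Lambda_r lam) (E_r lam \<alpha>) (S_r \<alpha> sj se) dt \<rho> t p
        = deriv (\<lambda>\<tau>. \<rho> \<tau> p) t
          - lam\<^sup>2 / 8 * (\<alpha> + 3) * dt * \<sigma>j
            * (partial_x (partial_x (\<rho> t)) p + partial_y (partial_y (\<rho> t)) p))"
proof -
  let ?c = "lam\<^sup>2 / 8 * (\<alpha> + 3) * \<sigma>j"
  have alpha1: "alpha1 (Lambda_r lam) (E_r lam \<alpha>) = 0"
    using assms by (simp add: alpha1_eq_0)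
  have alpha2: "alpha2 (Lambda_r lam) (E_r lam \<alpha>) (S_r \<alpha> sj se) = - const_op ?c * (d_x\<^sup>2 + d_y\<^sup>2)"
    unfolding assms(7) using assms by (intro alpha2_eq) simp_all
  have "relaxation_form 7 (J_0r lam \<alpha> sj se) (E_r lam \<alpha>) (S_r \<alpha> sj se)"
    using assms by (intro relaxation_form_J_0r) simp_all
  then show ?thesis
    unfolding equivalent_pde_lhs_def alpha1 alpha2 apply_op_laplacian apply_op_zero
    by (simp add: algebra_simps)
qed

end
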